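(* Let $u_h\in V_h$ be the Galerkin solution, i.e. $a(u_h,v_h)=\ell(v_h)$ for all $v_h\in V_h$. Then $u_h$ admits the orthogonal decomposition $u_h=\Pi_M u_h+(I-\Pi_M)u_h$, where $(I-\Pi_M)u_h$ is $a$-orthogonal to $V_M^h$. Moreover, the reduced solution $u_{\mathrm{RD}}\in V_M^h$ obtained from the reduced variational problem $$a(u_{\mathrm{RD}},v_M)=\ell(v_M)\qquad\forall v_M\in V_M^h$$ coincides with the projection, $u_{\mathrm{RD}}=\Pi_M u_h$, and satisfies the best-approximation property $$\|u_h-u_{\mathrm{RD}}\|_a=\min_{v_M\in V_M^h}\|u_h-v_M\|_a,\qquad \|w\|_a^2:=a(w,w).$$
   Context: Let $\Omega=(0,1)^2$ and let $\kappa$ be a (measurable) coefficient on $\Omega$ with $0<\kappa_{\min}\le\kappa(x)\le\kappa_{\max}<\infty$ for all $x\in\Omega$. On $H_0^1(\Omega)$ define the bilinear form $a(u,v)=\int_\Omega\kappa\,\nabla u\cdot\nabla v\,dx$ and the bounded linear functional $\ell(v)=\int_\Omega f v\,dx$ for given data $f$. The form $a$ is symmetric, continuous and coercive on $H_0^1(\Omega)$. Let $V_h\subset H_0^1(\Omega)$ be a finite-dimensional subspace. For an integer $M\ge1$ let $\phi_{mn}(x,y)=\sin(m\pi x)\sin(n\pi y)$ be the Dirichlet Laplacian eigenfunctions on $\Omega$, and $V_M=\operatorname{span}\{\phi_{mn}:1\le m,n\le M\}$. Let $\Pi_h$ be a fixed projection or interpolation operator onto $V_h$ (e.g. nodal interpolation,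 $L^2$ projection or energy projection), applied to each $\phi_{mn}$, and set $V_M^h:=\Pi_hV_M\subset V_h$. The $a$-orthogonal projector $\Pi_M:V_h\to V_M^h$ is defined by $a(\Pi_Mv_h,v_M)=a(v_h,v_M)$ for all $v_M\in V_M^h$. *)

theory Defs
  imports "HOL-Analysis.Analysis"
begin

section \<open>The Hilbert space of square-integrable functions on the unit square\<close>

definition Omega :: "(real \<times> real) set" where
  "Omega = {0<..<1} \<times> {0<..<1}"

definition square_integrable :: "(real \<times> real \<Rightarrow> real) \<Rightarrow> bool" where
  "square_integrable f \<longleftrightarrow>
     f \<in> borel_measurable (lebesgue_on Omega) \<and> integrable (lebesgue_on Omega) (\<lambda>x. (f x)\<^sup>2)"

definition L2_eq :: "(real \<times> real \<Rightarrow> real) \<Rightarrow> (real \<times> real \<Rightarrow> real) \<Rightarrow> bool" where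
  "L2_eq f g \<longleftrightarrow> square_integrable f \<and> square_integrable g \<and> (AE x in lebesgue_on Omega. f x = g x)"

lemma square_integrable_zero: "square_integrable (\<lambda>x. 0)"
  by (simp add: square_integrable_def)

lemma square_integrable_mult:
  assumes "square_integrable f" "square_integrable g"
  shows "integrable (lebesgue_on Omega) (\<lambda>x. f x * g x)"
proof (rule Bochner_Integration.integrable_bound)
  show "integrable (lebesgue_on Omega) (\<lambda>x. (f x)\<^sup>2 + (g x)\<^sup>2)"
    using assms by (auto simp: square_integrable_def)
  show "(\<lambda>x. f x * g x) \<in> borel_measurable (lebesgue_on Omega)"
    using assms by (auto simp: square_integrable_def)
  have "\<bar>a * b\<bar> \<le> a\<^sup>2 + b\<^sup>2" for a b :: real
  proof -
    have "0 \<le> (\<bar>a\<bar> - \<bar>b\<bar>)\<^sup>2" by simp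
    then have "2 * (\<bar>a\<bar> * \<bar>b\<bar>) \<le> a\<^sup>2 + b\<^sup>2"
      by (simp add: power2_eq_square algebra_simps)
    moreover have "0 \<le> \<bar>a\<bar> * \<bar>b\<bar>" by simp
    ultimately show ?thesis unfolding abs_mult by linarith
  qed
  then show "AE x in lebesgue_on Omega. norm (f x * g x) \<le> norm ((f x)\<^sup>2 + (g x)\<^sup>2)"
    by simp
qed

lemma square_integrable_add:
  assumes "square_integrable f" "square_integrable g"
  shows "square_integrable (\<lambda>x. f x + g x)"
proof -
  have "integrable (lebesgue_on Omega) (\<lambda>x. (f x)\<^sup>2 + (g x)\<^sup>2 + 2 * (f x * g x))"
    using assms square_integrable_mult[OF assms]
    by (intro Bochner_Integration.integrable_add integrable_mult_right) (auto simp: square_integrable_def)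
  then show ?thesis
    using assms by (auto simp: square_integrable_def power2_sum algebra_simps)
qed

lemma square_integrable_scale:
  "square_integrable f \<Longrightarrow> square_integrable (\<lambda>x. c * f x)"
  by (auto simp: square_integrable_def power_mult_distrib)

lemma part_equivp_L2_eq: "part_equivp L2_eq"
proof (rule part_equivpI)
  show "\<exists>x. L2_eq x x"
    using square_integrable_zero by (auto simp: L2_eq_def)
  show "symp L2_eq"
    by (rule sympI) (auto simp: L2_eq_def elim: eventually_mono)
  show "transp L2_eq"
    by (rule transpI) (auto simp: L2_eq_def elim: eventually_elim2)
qed

quotient_type L2 = "real \<times> real \<Rightarrow> real" / partial: L2_eq
  by (rule part_equivp_L2_eq)

text \<open>\<^term>\<open>rep_L2 u\<close> is some representative of the class \<^term>\<open>u\<close> and \<^term>\<open>abs_L2 f\<close> is the class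
  of a square-integrable function \<^term>\<open>f\<close>.  Integrals over \<^term>\<open>Omega\<close> do not depend on the
  representative.\<close>

instantiation L2 :: real_vector
begin

lift_definition zero_L2 :: L2 is "\<lambda>x. 0"
  by (simp add: L2_eq_def square_integrable_zero)

lift_definition plus_L2 :: "L2 \<Rightarrow> L2 \<Rightarrow> L2" is "\<lambda>f g x. f x + g x"
  by (auto simp: L2_eq_def square_integrable_add elim: eventually_elim2)

lift_definition scaleR_L2 :: "real \<Rightarrow> L2 \<Rightarrow> L2" is "\<lambda>c f x. c * f x"
  by (auto simp: L2_eq_def square_integrable_scale elim: eventually_mono)

definition uminus_L2 :: "L2 \<Rightarrow> L2" where "uminus_L2 u = (-1) *\<^sub>R u"

definition minus_L2 :: "L2 \<Rightarrow> L2 \<Rightarrow> L2" where "minus_L2 u v = u + (- v)"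

instance
proof
  fix u v w :: L2 and c d :: real
  show "u + v + w = u + (v + w)"
    by transfer (auto simp: L2_eq_def square_integrable_add algebra_simps)
  show "u + v = v + u"
    by transfer (auto simp: L2_eq_def square_integrable_add algebra_simps)
  show "0 + u = u"
    by transfer (auto simp: L2_eq_def)
  show "- u + u = 0"
    unfolding uminus_L2_def
    by transfer (auto simp: L2_eq_def square_integrable_zero)
  show "u - v = u + - v"
    by (simp add: minus_L2_def)
  show "c *\<^sub>R (u + v) = c *\<^sub>R u + c *\<^sub>R v"
    by transfer (auto simp: L2_eq_def algebra_simps intro!: square_integrable_add square_integrable_scale)
  show "(c + d) *\<^sub>R u = c *\<^sub>R u + d *\<^sub>R u"
    by transfer (auto simp: L2_eq_def distrib_right intro!: square_integrable_add square_integrable_scale)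
  show "c *\<^sub>R d *\<^sub>R u = (c * d) *\<^sub>R u"
    by transfer (auto simp: L2_eq_def mult.assoc intro!: square_integrable_scale)
  show "1 *\<^sub>R u = u"
    by transfer (auto simp: L2_eq_def)
qed

end

instantiation L2 :: real_inner
begin

lift_definition inner_L2 :: "L2 \<Rightarrow> L2 \<Rightarrow> real" is "\<lambda>f g. LINT x|lebesgue_on Omega. f x * g x"
  by (rule integral_cong_AE)
     (auto simp: L2_eq_def square_integrable_def elim: eventually_elim2)

definition norm_L2 :: "L2 \<Rightarrow> real" where "norm_L2 u = sqrt (u \<bullet> u)"

definition dist_L2 :: "L2 \<Rightarrow> L2 \<Rightarrow> real" where "dist_L2 u v = norm (u - v)"

definition sgn_L2 :: "L2 \<Rightarrow> L2" where "sgn_L2 u = inverse (norm u) *\<^sub>R u"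

definition uniformity_L2 :: "(L2 \<times> L2) filter" where
  "uniformity_L2 = (INF e\<in>{0 <..}. principal {(u, v). dist u v < e})"

definition open_L2 :: "L2 set \<Rightarrow> bool" where
  "open_L2 U = (\<forall>u\<in>U. eventually (\<lambda>(u', v). u' = u \<longrightarrow> v \<in> U) uniformity)"

instance
proof
  fix u v w :: L2 and c :: real and U :: "L2 set"
  show "dist u v = norm (u - v)" by (rule dist_L2_def)
  show "sgn u = inverse (norm u) *\<^sub>R u" by (rule sgn_L2_def)
  show "uniformity = (INF e\<in>{0 <..}. principal {(u, v::L2). dist u v < e})"
    by (rule uniformity_L2_def)
  show "open U = (\<forall>u\<in>U. eventually (\<lambda>(u', v). u' = u \<longrightarrow> v \<in> U) uniformity)"
    by (rule open_L2_def)
  show "norm u = sqrt (u \<bullet> u)" by (rule norm_L2_def)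
  show "u \<bullet> v = v \<bullet> u"
    by transfer (simp add: mult.commute)
  show "(u + v) \<bullet> w = u \<bullet> w + v \<bullet> w"
    by transfer (auto simp: L2_eq_def distrib_right square_integrable_mult)
  show "(c *\<^sub>R u) \<bullet> v = c * (u \<bullet> v)"
    by transfer (auto simp: mult.assoc)
  show "0 \<le> u \<bullet> u"
    by transfer simp
  show "(u \<bullet> u = 0) = (u = 0)"
  proof transfer
    fix f assume "L2_eq f f"
    then have f: "square_integrable f" by (simp add: L2_eq_def)
    have "(LINT x|lebesgue_on Omega. f x * f x) = 0 \<longleftrightarrow> (AE x in lebesgue_on Omega. f x * f x = 0)"
      by (rule integral_nonneg_eq_0_iff_AE) (use square_integrable_mult[OF f f] in auto)
    then show "((LINT x|lebesgue_on Omega. f x * f x) = 0) = L2_eq f (\<lambda>x. 0)"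
      using f by (simp add: L2_eq_def square_integrable_zero)
  qed
qed

end


section \<open>The Sobolev space with zero boundary values\<close>

primrec C_k :: "nat \<Rightarrow> (real \<times> real \<Rightarrow> real) \<Rightarrow> bool" where
  "C_k 0 \<phi> \<longleftrightarrow> continuous_on UNIV \<phi>"
| "C_k (Suc k) \<phi> \<longleftrightarrow>
     (\<forall>x. \<phi> differentiable (at x)) \<and> (\<forall>e\<in>Basis. C_k k (\<lambda>x. frechet_derivative \<phi> (at x) e))"

text \<open>Smooth functions with compact support in \<^term>\<open>Omega\<close>, extended by zero to the plane.\<close>

definition test_fun :: "(real \<times> real \<Rightarrow> real) \<Rightarrow> bool" where
  "test_fun \<phi> \<longleftrightarrow> (\<forall>k. C_k k \<phi>) \<and> (\<exists>K. compact K \<and> K \<subseteq> Omega \<and> (\<forall>x. x \<notin> K \<longrightarrow> \<phi> x = 0))"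

text \<open>The coordinate directions are the elements \<open>(1, 0)\<close> and \<open>(0, 1)\<close> of \<^term>\<open>Basis\<close>.\<close>

definition is_weak_partial :: "real \<times> real \<Rightarrow> L2 \<Rightarrow> L2 \<Rightarrow> bool" where
  "is_weak_partial e u g \<longleftrightarrow>
     (\<forall>\<phi>. test_fun \<phi> \<longrightarrow>
        (LINT x|lebesgue_on Omega. rep_L2 u x * frechet_derivative \<phi> (at x) e)
          = - (LINT x|lebesgue_on Omega. rep_L2 g x * \<phi> x))"

definition weak_partial :: "real \<times> real \<Rightarrow> L2 \<Rightarrow> L2" where
  "weak_partial e u = (THE g. is_weak_partial e u g)"

definition H1 :: "L2 set" where
  "H1 = {u. \<forall>e\<in>Basis. \<exists>g. is_weak_partial e u g}"

definition H1_norm :: "L2 \<Rightarrow> real" where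
  "H1_norm u = sqrt ((norm u)\<^sup>2 + (\<Sum>e\<in>Basis. (norm (weak_partial e u))\<^sup>2))"

text \<open>The closure of the test functions in \<^term>\<open>H1\<close>.\<close>

definition H10 :: "L2 set" where
  "H10 = {u \<in> H1. \<forall>\<epsilon>>0. \<exists>\<phi>. test_fun \<phi> \<and> H1_norm (u - abs_L2 \<phi>) < \<epsilon>}"


section \<open>The variational problem\<close>

definition energy_form :: "(real \<times> real \<Rightarrow> real) \<Rightarrow> L2 \<Rightarrow> L2 \<Rightarrow> real" where
  "energy_form \<kappa> u v =
     (LINT x|lebesgue_on Omega.
        \<kappa> x * (\<Sum>e\<in>Basis. rep_L2 (weak_partial e u) x * rep_L2 (weak_partial e v) x))"

definition energy_norm :: "(real \<times> real \<Rightarrow> real) \<Rightarrow> L2 \<Rightarrow> real" where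
  "energy_norm \<kappa> w = sqrt (energy_form \<kappa> w w)"

definition load :: "(real \<times> real \<Rightarrow> real) \<Rightarrow> L2 \<Rightarrow> real" where
  "load f v = (LINT x|lebesgue_on Omega. f x * rep_L2 v x)"

text \<open>The data for which the load is a well-defined bounded linear functional on \<^term>\<open>H10\<close>; this
  includes all square-integrable \<^term>\<open>f\<close>.\<close>

definition admissible_data :: "(real \<times> real \<Rightarrow> real) \<Rightarrow> bool" where
  "admissible_data f \<longleftrightarrow>
     (\<forall>v\<in>H10. integrable (lebesgue_on Omega) (\<lambda>x. f x * rep_L2 v x)) \<and>
     (\<exists>C. \<forall>v\<in>H10. \<bar>load f v\<bar> \<le> C * H1_norm v)"

definition galerkin_solution ::
    "(real \<times> real \<Rightarrow> real) \<Rightarrow> (real \<times> real \<Rightarrow> real) \<Rightarrow> L2 set \<Rightarrow> L2 \<Rightarrow> bool" where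
  "galerkin_solution \<kappa> f V u \<longleftrightarrow> u \<in> V \<and> (\<forall>v\<in>V. energy_form \<kappa> u v = load f v)"


section \<open>The reduced space and the energy-orthogonal projector\<close>

definition sine_mode :: "nat \<Rightarrow> nat \<Rightarrow> real \<times> real \<Rightarrow> real" where
  "sine_mode m n = (\<lambda>(x, y). sin (real m * pi * x) * sin (real n * pi * y))"

definition sine_space :: "nat \<Rightarrow> L2 set" where
  "sine_space M = span {abs_L2 (sine_mode m n) | m n. m \<in> {1..M} \<and> n \<in> {1..M}}"

text \<open>The operator acts on a domain \<^term>\<open>D\<close> that need not be the whole space: nodal interpolation
  is only meaningful for functions with a continuous representative.\<close>

definition linear_projection_onto :: "L2 set \<Rightarrow> L2 set \<Rightarrow> (L2 \<Rightarrow> L2) \<Rightarrow> bool" where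
  "linear_projection_onto D V P \<longleftrightarrow>
     subspace D \<and> V \<subseteq> D \<and>
     (\<forall>u\<in>D. \<forall>v\<in>D. P (u + v) = P u + P v) \<and>
     (\<forall>c. \<forall>u\<in>D. P (c *\<^sub>R u) = c *\<^sub>R P u) \<and>
     P ` D \<subseteq> V \<and> (\<forall>v\<in>V. P v = v)"

definition reduced_space :: "(L2 \<Rightarrow> L2) \<Rightarrow> nat \<Rightarrow> L2 set" where
  "reduced_space P M = P ` sine_space M"

definition energy_projector :: "(real \<times> real \<Rightarrow> real) \<Rightarrow> L2 set \<Rightarrow> L2 \<Rightarrow> L2" where
  "energy_projector \<kappa> W v =
     (THE w. w \<in> W \<and> (\<forall>z\<in>W. energy_form \<kappa> w z = energy_form \<kappa> v z))"

end

theory Submission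
  imports Defs
begin

text \<open>The energy form is a positive definite symmetric bilinear form on the Galerkin space, so the
  theorem is linear algebra: the projection onto the finite-dimensional reduced space exists by
  Gram-Schmidt, the reduced problem is the projection problem for \<open>u\<^sub>h\<close>, and best approximation is
  Pythagoras.

  What has to be supplied are bilinearity and definiteness. The weak partial derivative is given by a
  definite description, so bilinearity requires uniqueness of weak derivatives, i.e. the
  fundamental lemma of the calculus of variations: smooth functions approximate indicators of boxes,
  and a function whose integral over every box vanishes is zero almost everywhere. Definiteness
  follows from the Poincare inequality for test functions and density.\<close>

section \<open>Smooth bump functions\<close>

text \<open>Functions of this shape are closed under differentiation, which gives smoothness at
  \<^term>\<open>0::real\<close> without computing any higher derivative.\<close>

definition flat :: "real poly \<Rightarrow> real \<Rightarrow> real" where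
  "flat p t = (if t > 0 then poly p (1 / t) * exp (- (1 / t)) else 0)"

lemma poly_div_exp_tendsto_0: "((\<lambda>x. poly p x / exp x) \<longlongrightarrow> (0::real)) at_top"
proof -
  have "((\<lambda>x. \<Sum>i\<le>degree p. coeff p i * (x ^ i / exp x)) \<longlongrightarrow> (\<Sum>i\<le>degree p. coeff p i * 0)) at_top"
    by (intro tendsto_intros tendsto_power_div_exp_0)
  then show ?thesis
    by (simp add: poly_altdef sum_divide_distrib)
qed

text \<open>From the right, the substitution \<open>inverse t\<close> turns the claim into the
  growth of the exponential over polynomials at infinity; from the left the function is identically
  zero.\<close>

lemma flat_tendsto_0: "(flat p \<longlongrightarrow> 0) (at 0)"
proof (rule filterlim_split_at_real)
  show "(flat p \<longlongrightarrow> 0) (at_left 0)"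
    by (rule tendsto_eventually) (auto simp: eventually_at_filter flat_def)
  have "((\<lambda>t. poly p (inverse t) / exp (inverse t)) \<longlongrightarrow> 0) (at_right (0::real))"
    using poly_div_exp_tendsto_0 filterlim_inverse_at_top_right by (rule filterlim_compose)
  then show "(flat p \<longlongrightarrow> 0) (at_right 0)"
    by (rule Lim_transform_eventually)
       (auto simp: eventually_at_filter flat_def exp_minus field_simps)
qed

text \<open>With \<open>s = 1 / t\<close>, the derivative of \<open>p(s) * exp (- s)\<close> in
  \<open>t\<close> is \<open>s^2 * (p(s) - p'(s)) * exp (- s)\<close>; the factor
  \<open>[:0, 0, 1:]\<close> is \<open>s^2\<close>.\<close>

lemma flat_has_derivative:
  "(flat p has_real_derivative flat ([:0, 0, 1:] * (p - pderiv p)) t) (at t)"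
proof -
  consider "t > 0" | "t < 0" | "t = 0" by linarith
  then show ?thesis
  proof cases
    case 1
    have "((\<lambda>t. poly p (1 / t) * exp (- (1 / t))) has_real_derivative
        flat ([:0, 0, 1:] * (p - pderiv p)) t) (at t)"
      using 1 by (auto intro!: derivative_eq_intros DERIV_chain2[OF poly_DERIV]
          simp: flat_def algebra_simps power2_eq_square)
    then show ?thesis
      by (rule has_field_derivative_transform_within_open[of _ _ _ "{0<..}"])
         (use 1 in \<open>auto simp: flat_def\<close>)
  next
    case 2
    have "((\<lambda>t. 0) has_real_derivative 0) (at t)" by simp
    then have "(flat p has_real_derivative 0) (at t)"
      by (rule has_field_derivative_transform_within_open[of _ _ _ "{..<0}"])
         (use 2 in \<open>auto simp: flat_def\<close>)
    then show ?thesis using 2 by (simp add: flat_def)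
  next
    case 3
    \<comment> \<open>Dividing by \<open>h\<close> multiplies the polynomial in \<open>1 / h\<close>
      by its variable, so the difference quotient at the origin is
      \<open>flat (pCons 0 p)\<close>.\<close>
    have "((\<lambda>h. flat p h / h) \<longlongrightarrow> 0) (at 0)"
      by (rule Lim_transform_eventually[OF flat_tendsto_0[of "pCons 0 p"]])
         (auto simp: eventually_at_filter flat_def)
    then show ?thesis using 3
      by (simp add: has_field_derivative_iff flat_def)
  qed
qed

text \<open>An algebra closed under partial derivatives: all its members are smooth, although
  \<^const>\<open>C_k\<close> itself is never shown to be closed under products.\<close>

inductive_set ridge_algebra :: "(real \<times> real \<Rightarrow> real) set" where
  ridge: "(\<lambda>x. flat p (l \<bullet> x + c)) \<in> ridge_algebra"
| add: "f \<in> ridge_algebra \<Longrightarrow> g \<in> ridge_algebra \<Longrightarrow> (\<lambda>x. f x + g x) \<in> ridge_algebra"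
| mult: "f \<in> ridge_algebra \<Longrightarrow> g \<in> ridge_algebra \<Longrightarrow> (\<lambda>x. f x * g x) \<in> ridge_algebra"

lemma flat_smult: "flat (smult c p) t = c * flat p t"
  by (simp add: flat_def)

lemma ridge_algebra_derivative:
  assumes "f \<in> ridge_algebra"
  shows "\<exists>f'. (\<forall>x. (f has_derivative f' x) (at x)) \<and> (\<forall>e. (\<lambda>x. f' x e) \<in> ridge_algebra)"
  using assms
proof induction
  case (ridge p l c)
  define q where "q = [:0, 0, 1:] * (p - pderiv p)"
  have "((\<lambda>x. flat p (l \<bullet> x + c)) has_derivative (\<lambda>h. flat q (l \<bullet> x + c) * (l \<bullet> h))) (at x)" for x
    unfolding q_def
    by (rule has_derivative_compose[OF _ flat_has_derivative[unfolded has_field_derivative_def]])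
       (auto intro!: derivative_eq_intros)
  \<comment> \<open>Scalars are not generators of the algebra; the constant
    \<open>l \<bullet> e\<close> is absorbed into the polynomial.\<close>
  moreover have "(\<lambda>x. flat q (l \<bullet> x + c) * (l \<bullet> e)) \<in> ridge_algebra" for e
    using ridge_algebra.ridge[of "smult (l \<bullet> e) q" l c] by (simp add: flat_smult mult.commute)
  ultimately show ?case by (intro exI[of _ "\<lambda>x h. flat q (l \<bullet> x + c) * (l \<bullet> h)"]) auto
next
  case (add f g)
  then obtain f' g' where "\<And>x. (f has_derivative f' x) (at x)" "\<And>e. (\<lambda>x. f' x e) \<in> ridge_algebra"
    "\<And>x. (g has_derivative g' x) (at x)" "\<And>e. (\<lambda>x. g' x e) \<in> ridge_algebra" by metis
  then show ?case
    by (intro exI[of _ "\<lambda>x h. f' x h + g' x h"])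
       (auto intro!: derivative_eq_intros ridge_algebra.intros)
next
  case (mult f g)
  then obtain f' g' where "\<And>x. (f has_derivative f' x) (at x)" "\<And>e. (\<lambda>x. f' x e) \<in> ridge_algebra"
    "\<And>x. (g has_derivative g' x) (at x)" "\<And>e. (\<lambda>x. g' x e) \<in> ridge_algebra" by metis
  then show ?case using mult
    by (intro exI[of _ "\<lambda>x h. f x * g' x h + f' x h * g x"])
       (auto intro!: has_derivative_mult ridge_algebra.intros)
qed

lemma ridge_algebra_C_k: "f \<in> ridge_algebra \<Longrightarrow> C_k k f"
proof (induction k arbitrary: f)
  case 0
  then show ?case
    using ridge_algebra_derivative[OF 0]
    by (auto simp: continuous_on_eq_continuous_at intro: has_derivative_continuous)
next
  case (Suc k)
  then obtain f' where f': "\<And>x. (f has_derivative f' x) (at x)" "\<And>e. (\<lambda>x. f' x e) \<in> ridge_algebra"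
    using ridge_algebra_derivative by metis
  have "(\<lambda>x. frechet_derivative f (at x) e) = (\<lambda>x. f' x e)" for e
    using f'(1)[THEN frechet_derivative_at] by auto
  then show ?case
    using f' Suc.IH by (simp add: differentiable_def) blast
qed

text \<open>The offset \<open>- 1\<close> keeps the support at distance \<open>1 / n\<close> from the boundary of the box, which makes it
  a compact subset of the open box.\<close>

definition box_bump :: "real \<times> real \<Rightarrow> real \<times> real \<Rightarrow> nat \<Rightarrow> real \<times> real \<Rightarrow> real" where
  "box_bump a b n x =
     flat 1 (real n * (fst x - fst a) - 1) * flat 1 (real n * (fst b - fst x) - 1) *
     (flat 1 (real n * (snd x - snd a) - 1) * flat 1 (real n * (snd b - snd x) - 1))"

lemma box_bump_ridge_algebra: "box_bump a b n \<in> ridge_algebra"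
proof -
  have "flat 1 (real n * (fst x - fst a) - 1) = flat 1 ((real n, 0) \<bullet> x + (- real n * fst a - 1))"
    "flat 1 (real n * (fst b - fst x) - 1) = flat 1 ((- real n, 0) \<bullet> x + (real n * fst b - 1))"
    "flat 1 (real n * (snd x - snd a) - 1) = flat 1 ((0, real n) \<bullet> x + (- real n * snd a - 1))"
    "flat 1 (real n * (snd b - snd x) - 1) = flat 1 ((0, - real n) \<bullet> x + (real n * snd b - 1))" for x
    by (auto simp: inner_prod_def algebra_simps)
  then show ?thesis
    unfolding box_bump_def[abs_def]
    by (simp only:) (intro ridge_algebra.intros)
qed

lemma flat_1_bounds: "0 \<le> flat 1 t" "flat 1 t \<le> 1"
  by (auto simp: flat_def)

lemma box_bump_bounds: "0 \<le> box_bump a b n x" "box_bump a b n x \<le> 1"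
  unfolding box_bump_def
  by (intro mult_nonneg_nonneg flat_1_bounds mult_le_one)+

text \<open>For positive \<open>s\<close> the argument tends to infinity, where
  \<open>exp (- (1 / t))\<close> tends to 1; otherwise it never exceeds -1 and every term is
  zero.\<close>

lemma flat_1_tendsto: "(\<lambda>n. flat 1 (real n * s - 1)) \<longlonglongrightarrow> (if s > 0 then 1 else 0)"
proof (cases "s > 0")
  case True
  have top: "filterlim (\<lambda>n. real n * s - 1) at_top sequentially"
    using True
    by (intro filterlim_tendsto_add_at_top[OF tendsto_const[of "- 1"], simplified]
        filterlim_at_top_mult_tendsto_pos[OF tendsto_const] filterlim_real_sequentially)
  then have "(\<lambda>n. exp (- inverse (real n * s - 1))) \<longlonglongrightarrow> exp (- 0)"
    by (intro tendsto_intros tendsto_inverse_0_at_top)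
  then have "(\<lambda>n. flat 1 (real n * s - 1)) \<longlonglongrightarrow> exp (- 0)"
    by (rule Lim_transform_eventually)
       (use filterlim_at_top_dense[THEN iffD1, OF top, rule_format, of 0] in
         \<open>auto elim!: eventually_mono simp: flat_def inverse_eq_divide\<close>)
  then show ?thesis using True by simp
next
  case False
  then have "real n * s \<le> 0" for n by (simp add: mult_nonneg_nonpos)
  then have "flat 1 (real n * s - 1) = 0" for n by (smt (verit) flat_def)
  then show ?thesis using False by simp
qed

lemma box_prod_iff:
  fixes a b x :: "real \<times> real"
  shows "x \<in> box a b \<longleftrightarrow> fst a < fst x \<and> fst x < fst b \<and> snd a < snd x \<and> snd x < snd b"
  by (auto simp: box_def Basis_prod_def inner_prod_def)

lemma box_bump_tendsto: "(\<lambda>n. box_bump a b n x) \<longlonglongrightarrow> indicator (box a b) x"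
proof -
  have eq: "indicator (box a b) x =
     (if fst x - fst a > 0 then 1 else 0) * (if fst b - fst x > 0 then 1 else 0) *
     ((if snd x - snd a > 0 then 1 else 0) * (if snd b - snd x > 0 then 1 else 0 :: real))"
    by (auto simp: indicator_def box_prod_iff)
  show ?thesis
    unfolding eq box_bump_def by (intro tendsto_mult flat_1_tendsto)
qed

lemma Omega_eq_box: "Omega = box (0, 0) (1, 1)"
  by (auto simp: Omega_def box_prod_iff)

text \<open>The box may reach beyond the unit square; the second factor cuts the support down to a
  compact part of \<open>Omega\<close>.\<close>

lemma box_bump_test_fun: "test_fun (\<lambda>x. box_bump a b n x * box_bump (0, 0) (1, 1) n x)"
  unfolding test_fun_def
proof (intro conjI allI exI)
  show "C_k k (\<lambda>x. box_bump a b n x * box_bump (0, 0) (1, 1) n x)" for k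
    by (intro ridge_algebra_C_k ridge_algebra.mult box_bump_ridge_algebra)
  \<comment> \<open>For \<open>n = 0\<close> division by zero would make the box the closed unit
    square, which is not inside \<open>Omega\<close>. The bump then vanishes identically, so the
    empty set serves.\<close>
  let ?K = "cbox (1 / real n, 1 / real n) (1 - 1 / real n, 1 - 1 / real n) \<inter> (if n = 0 then {} else UNIV)"
  show "compact ?K" by auto
  show "?K \<subseteq> Omega"
    by (auto simp: Omega_def cbox_Pair_eq) (smt (verit) divide_pos_pos of_nat_0_less_iff)+
  fix x show "x \<notin> ?K \<longrightarrow> box_bump a b n x * box_bump (0, 0) (1, 1) n x = 0"
    by (cases x) (auto simp: box_bump_def flat_def cbox_Pair_eq field_simps split: if_splits)
qed

section \<open>Integration by parts and the fundamental lemma\<close>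

lemma lborel_translation_invariant:
  fixes f :: "'a::euclidean_space \<Rightarrow> real"
  assumes "f \<in> borel_measurable borel"
  shows "(LINT x|lborel. f (x + c)) = (LINT x|lborel. f x)"
proof -
  have "(LINT x|lborel. f x) = (LINT x|distr lborel borel ((+) c). f x)"
    by (simp only: lborel_distr_plus)
  also have "\<dots> = (LINT x|lborel. f (c + x))"
    using assms by (subst integral_distr) auto
  finally show ?thesis by (simp add: add.commute)
qed

text \<open>The complement of \<open>K\<close> is open and \<open>F\<close> agrees there with the
  zero function, so derivatives agree by uniqueness.\<close>

lemma derivative_zero_outside_compact:
  fixes F :: "'a::real_normed_vector \<Rightarrow> 'b::real_normed_vector"
  assumes deriv: "(F has_derivative F') (at x)"
    and K: "compact K" "\<And>x. x \<notin> K \<Longrightarrow> F x = 0" "x \<notin> K"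
  shows "F' = (\<lambda>h. 0)"
proof -
  have "((\<lambda>x. 0) has_derivative (\<lambda>h. 0)) (at x)" by simp
  then have "(F has_derivative (\<lambda>h. 0)) (at x)"
    by (rule has_derivative_transform_within_open[of _ _ _ _ "- K"])
       (use K in \<open>auto simp: compact_imp_closed open_Compl\<close>)
  then show ?thesis using has_derivative_unique[OF deriv] by simp
qed

text \<open>The integrals of the difference quotients vanish by translation invariance and converge to
  the integral of the derivative.\<close>

lemma integral_derivative_compact_support:
  fixes F :: "'a::euclidean_space \<Rightarrow> real"
  assumes deriv: "\<And>x. (F has_derivative F' x) (at x)"
    and cont: "continuous_on UNIV (\<lambda>x. F' x e)"
    and K: "compact K" "\<And>x. x \<notin> K \<Longrightarrow> F x = 0"
  shows "(LINT x|lborel. F' x e) = 0"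
proof -
  have F: "continuous_on UNIV F"
    by (auto simp: continuous_on_eq_continuous_at intro!: has_derivative_continuous deriv)
  have [measurable]: "F \<in> borel_measurable borel" "(\<lambda>x. F' x e) \<in> borel_measurable borel"
    using F cont by (auto intro: borel_measurable_continuous_onI)
  have F'0: "F' x e = 0" if "x \<notin> K" for x
    using derivative_zero_outside_compact[OF deriv K that] by simp
  obtain C where C: "\<And>x. norm (F' x e) \<le> C"
  proof -
    have "bounded ((\<lambda>x. F' x e) ` K)"
      using K cont by (intro compact_imp_bounded compact_continuous_image) (auto intro: continuous_on_subset)
    then obtain C where "\<And>x. x \<in> K \<Longrightarrow> norm (F' x e) \<le> C" unfolding bounded_iff by auto
    then have "norm (F' x e) \<le> max C 0" for x using F'0[of x] by (cases "x \<in> K") (fastforce intro: order_trans)+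
    then show thesis by (rule that)
  qed
  have C0: "C \<ge> 0" using C[of 0] by (meson norm_ge_zero order_trans)
  \<comment> \<open>\<open>B\<close> is \<open>K\<close> thickened by \<open>norm e\<close>.
    Difference quotients along \<open>e\<close> with step at most 1 vanish outside it, so
    \<open>C * indicator B\<close> dominates them all.\<close>
  define B where "B = {x + y | x y. x \<in> K \<and> y \<in> cball 0 (norm e)}"
  have "compact B" unfolding B_def using K by (intro compact_sums) auto
  then have dom: "integrable lborel (\<lambda>x. C * indicator B x)" 
    by (intro integrable_mult_right integrable_real_indicator)
       (auto simp: borel_compact emeasure_compact_finite[unfolded infinity_ennreal_def])
  have KB: "x \<in> B" if "x + t *\<^sub>R e \<in> K" "\<bar>t\<bar> \<le> 1" for x t
    unfolding B_def
  proof (intro CollectI exI conjI)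
    show "x = (x + t *\<^sub>R e) + - (t *\<^sub>R e)" by simp
    show "- (t *\<^sub>R e) \<in> cball 0 (norm e)" using that by (auto simp: mult_left_le_one_le)
  qed (use that in auto)
  have K_sub: "x \<in> B" if "x \<in> K" for x using KB[of x 0] that by simp
  define q where "q n x = (F (x + (1 / real (Suc n)) *\<^sub>R e) - F x) * real (Suc n)" for n x
  have line: "((\<lambda>s. F (x + s *\<^sub>R e)) has_real_derivative F' (x + s *\<^sub>R e) e) (at s)" for x s
    unfolding has_field_derivative_def
  proof (rule has_derivative_eq_rhs)
    show "((\<lambda>s. F (x + s *\<^sub>R e)) has_derivative (\<lambda>h. F' (x + s *\<^sub>R e) (h *\<^sub>R e))) (at s)"
      by (rule has_derivative_compose[OF _ deriv]) (auto intro!: derivative_eq_intros)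
    show "(\<lambda>h. F' (x + s *\<^sub>R e) (h *\<^sub>R e)) = (*) (F' (x + s *\<^sub>R e) e)"
      using linear_scale[OF has_derivative_linear[OF deriv]] by (auto simp: fun_eq_iff)
  qed
  have "(\<lambda>n. LINT x|lborel. q n x) \<longlonglongrightarrow> (LINT x|lborel. F' x e)"
  proof (rule integral_dominated_convergence[OF _ _ dom])
    show "AE x in lborel. (\<lambda>n. q n x) \<longlonglongrightarrow> F' x e"
    proof (rule AE_I2)
      fix x
      have "((\<lambda>h. (F (x + h *\<^sub>R e) - F x) / h) \<longlongrightarrow> F' x e) (at 0)"
        using line[of x 0] by (simp add: has_field_derivative_iff)
      moreover have "filterlim (\<lambda>n. 1 / real (Suc n)) (at 0) sequentially"
        unfolding filterlim_at using lim_inverse_n' by (auto intro!: LIMSEQ_Suc simp del: of_nat_Suc)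
      ultimately have "(\<lambda>n. (F (x + (1 / real (Suc n)) *\<^sub>R e) - F x) / (1 / real (Suc n))) \<longlonglongrightarrow> F' x e"
        by (rule filterlim_compose)
      then show "(\<lambda>n. q n x) \<longlonglongrightarrow> F' x e" by (simp add: q_def)
    qed
    show "AE x in lborel. norm (q n x) \<le> C * indicator B x" for n
    proof (rule AE_I2)
      fix x
      define t where "t = 1 / real (Suc n)"
      have t: "0 < t" "t \<le> 1" unfolding t_def by auto
      \<comment> \<open>The mean value theorem along the line turns the bound on the derivative into
        one on the quotients, uniform in \<open>n\<close>.\<close>
      obtain z where "F (x + t *\<^sub>R e) - F (x + 0 *\<^sub>R e) = (t - 0) * F' (x + z *\<^sub>R e) e"
        using MVT2[OF t(1) line[of x]] by metis
      then have "q n x = F' (x + z *\<^sub>R e) e"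
        using t by (simp add: q_def t_def field_simps)
      then have "norm (q n x) \<le> C" using C by simp
      moreover have "q n x = 0" if "x \<notin> B"
        using KB[of x t] K_sub[of x] K(2) that t by (force simp: q_def t_def)
      ultimately show "norm (q n x) \<le> C * indicator B x" by (auto simp: indicator_def)
    qed
  qed (auto simp: q_def)
  moreover have "(LINT x|lborel. q n x) = 0" for n
  proof -
    have "integrable lborel F"
    proof -
      have "set_integrable lborel K F"
        unfolding set_integrable_def using K F by (intro borel_integrable_compact) (auto intro: continuous_on_subset)
      then show ?thesis unfolding set_integrable_def
        by (rule back_subst[of "integrable lborel"]) (use K in \<open>auto simp: indicator_def fun_eq_iff\<close>)
    qed
    moreover have "integrable lborel (\<lambda>x. F (x + c))" for c
    proof -
      have "integrable (distr lborel borel ((+) c)) F" using \<open>integrable lborel F\<close> by (simp only: lborel_distr_plus)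
      then have "integrable lborel (\<lambda>x. F (c + x))" by (subst (asm) integrable_distr_eq) auto
      then show ?thesis by (simp add: add.commute)
    qed
    ultimately show ?thesis by (simp add: q_def lborel_translation_invariant)
  qed
  ultimately show "(LINT x|lborel. F' x e) = 0" by (simp add: LIMSEQ_const_iff)
qed

text \<open>Open boxes are an intersection-stable generator of the Borel sets, so vanishing
  integrals spread to all Borel sets by Dynkin's argument; then \<open>g\<close> and 0 are densities
  with the same integrals.\<close>

lemma AE_zero_if_box_integrals_zero:
  fixes g :: "'a::euclidean_space \<Rightarrow> real"
  assumes g: "integrable lborel g"
    and box: "\<And>a b. (LINT x:box a b|lborel. g x) = 0"
  shows "AE x in lborel. g x = 0"
proof -
  have [measurable]: "g \<in> borel_measurable borel" using g by auto
  have si: "set_integrable lborel A g" if "A \<in> sets borel" for A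
    using g that integrable_mult_indicator unfolding set_integrable_def by (metis sets_lborel)
  \<comment> \<open>Complements in the Dynkin argument need the integral over the whole space,
    obtained by exhausting it with boxes.\<close>
  have total: "(LINT x|lborel. g x) = 0"
  proof -
    let ?B = "\<lambda>n::nat. box (- (real n *\<^sub>R One)) (real n *\<^sub>R One) :: 'a set"
    have "(\<lambda>n. LINT x|lborel. indicator (?B n) x * g x) \<longlonglongrightarrow> (LINT x|lborel. g x)"
    proof (rule integral_dominated_convergence[where w = "\<lambda>x. norm (g x)"])
      show "AE x in lborel. (\<lambda>n. indicator (?B n) x * g x) \<longlonglongrightarrow> g x"
      proof (rule AE_I2, rule tendsto_eventually)
        fix x :: 'a
        obtain N where N: "x \<in> ?B N" using UN_box_eq_UNIV by blast
        have "x \<in> ?B n" if "n \<ge> N" for n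
        proof -
          have "real N \<le> real n" using that by simp
          then show ?thesis using N by (force simp: box_def)
        qed
        then show "\<forall>\<^sub>F n in sequentially. indicator (?B n) x * g x = g x"
          unfolding eventually_sequentially by (intro exI[of _ N]) auto
      qed
    qed (use g in \<open>auto simp: indicator_def\<close>)
    then show ?thesis using box by (simp add: set_lebesgue_integral_def LIMSEQ_const_iff)
  qed
  have "AE x in lborel. g x = (\<lambda>x. 0) x"
  proof (rule density_unique_real[OF g])
    fix A :: "'a set" assume "A \<in> sets lborel"
    then have A: "A \<in> sigma_sets UNIV (range (\<lambda>(a, b). box a b))"
      by (simp add: borel_eq_box)
    have "Int_stable (range (\<lambda>(a, b). box a b :: 'a set))"
      by (auto simp: Int_stable_def box_Int_box)
    moreover have "range (\<lambda>(a, b). box a b :: 'a set) \<subseteq> Pow UNIV" by simp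
    ultimately have "A \<in> sets borel \<and> (LINT x:A|lborel. g x) = 0"
      using A
    proof (rule sigma_sets_induct_disjoint)
      show "\<And>A. A \<in> range (\<lambda>(a, b). box a b :: 'a set) \<Longrightarrow> A \<in> sets borel \<and> (LINT x:A|lborel. g x) = 0"
        using box by auto
      show "{} \<in> sets borel \<and> (LINT x:{}|lborel. g x) = 0" by (simp add: set_lebesgue_integral_def)
      show "UNIV - A \<in> sets borel \<and> (LINT x:UNIV - A|lborel. g x) = 0"
        if A: "A \<in> sets borel \<and> (LINT x:A|lborel. g x) = 0" for A
      proof -
        have "(LINT x:A \<union> (UNIV - A)|lborel. g x) = (LINT x:A|lborel. g x) + (LINT x:UNIV - A|lborel. g x)"
          using A by (intro set_integral_Un si) auto
        then show ?thesis using A total by (auto simp: set_lebesgue_integral_def)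
      qed
      show "(\<Union>i. A i) \<in> sets borel \<and> (LINT x:(\<Union>i. A i)|lborel. g x) = 0"
        if A: "disjoint_family A" "\<And>i. A i \<in> sets borel \<and> (LINT x:A i|lborel. g x) = 0" for A :: "nat \<Rightarrow> 'a set"
      proof -
        have "(LINT x:(\<Union>i. A i)|lborel. g x) = (\<Sum>i. (LINT x:A i|lborel. g x))"
          using A by (intro lebesgue_integral_countable_add si) (auto simp: disjoint_family_on_def)
        then show ?thesis using A by auto
      qed
    qed
    then show "(LINT x:A|lborel. g x) = (LINT x:A|lborel. 0)" by simp
  qed simp
  then show ?thesis by simp
qed

section \<open>Passing between the square with Lebesgue measure and the plane with Borel
  measure\<close>

lemma Omega_lebesgue [measurable]: "Omega \<in> sets lebesgue"
  by (simp add: Omega_eq_box)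

lemma continuous_integrable_Omega:
  fixes f :: "real \<times> real \<Rightarrow> real"
  assumes "continuous_on UNIV f"
  shows "integrable (lebesgue_on Omega) f"
proof -
  have "set_integrable lborel (cbox (0, 0) (1, 1)) f"
    unfolding set_integrable_def using assms by (intro borel_integrable_compact) (auto intro: continuous_on_subset)
  then have "set_integrable lborel Omega f"
    by (rule set_integrable_subset) (auto simp: Omega_eq_box box_subset_cbox)
  then have "set_integrable lebesgue Omega f"
    unfolding set_integrable_def by (subst integrable_completion) (auto dest: borel_measurable_integrable)
  then show ?thesis
    by (simp add: integrable_restrict_space set_integrable_def)
qed

lemma square_integrable_continuous:
  "continuous_on UNIV f \<Longrightarrow> square_integrable f"
  unfolding square_integrable_def
  by (auto intro!: continuous_integrable_Omega continuous_intros borel_measurable_integrable)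

lemma integral_Omega_eq_lborel:
  fixes f :: "real \<times> real \<Rightarrow> real"
  assumes "f \<in> borel_measurable borel" "\<And>x. x \<notin> Omega \<Longrightarrow> f x = 0"
  shows "(LINT x|lebesgue_on Omega. f x) = (LINT x|lborel. f x)"
proof -
  have "(\<lambda>x. if x \<in> Omega then f x else 0) = f" using assms by auto
  then have "(LINT x|lebesgue_on Omega. f x) = (LINT x|lebesgue. f x)"
    using Lebesgue_Measure.integral_restrict_UNIV[OF Omega_lebesgue, of f] by simp
  also have "\<dots> = (LINT x|lborel. f x)" using assms by (intro integral_completion) auto
  finally show ?thesis .
qed

text \<open>Extension by zero, passage to a Borel version and testing with box bumps reduce the
  claim to vanishing integrals over boxes, by dominated convergence.\<close>

lemma fundamental_lemma:
  fixes g :: "real \<times> real \<Rightarrow> real"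
  assumes g: "integrable (lebesgue_on Omega) g"
    and test: "\<And>\<phi>. test_fun \<phi> \<Longrightarrow> (LINT x|lebesgue_on Omega. g x * \<phi> x) = 0"
  shows "AE x in lebesgue_on Omega. g x = 0"
proof -
  define G where "G x = (if x \<in> Omega then g x else 0)" for x
  have G: "integrable lebesgue G"
    using g by (simp add: G_def[abs_def] Lebesgue_Measure.integrable_restrict_UNIV)
  then obtain G' where [measurable]: "G' \<in> borel_measurable lborel" and AE: "AE x in lborel. G x = G' x"
    using completion_ex_borel_measurable_real[of G lborel] by auto
  have AE': "AE x in lebesgue. G x = G' x" using AE by (rule AE_completion)
  have "integrable lebesgue G'"
    using G AE' by (subst integrable_cong_AE[of _ _ G]) (auto simp: eq_commute intro: measurable_completion)
  then have G': "integrable lborel G'" by (simp add: integrable_completion)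
  have box: "(LINT x:box a b|lborel. G' x) = 0" for a b
  proof -
    define \<phi> where "\<phi> n x = box_bump a b n x * box_bump (0, 0) (1, 1) n x" for n x
    have \<phi>: "test_fun (\<phi> n)" for n unfolding \<phi>_def by (rule box_bump_test_fun)
    have [measurable]: "\<phi> n \<in> borel_measurable borel" for n
      using \<phi>[of n] by (intro borel_measurable_continuous_onI) (auto simp: test_fun_def dest: spec[of _ 0])
    have "(\<lambda>n. LINT x|lborel. G' x * \<phi> n x) \<longlonglongrightarrow> (LINT x|lborel. indicator (box a b) x * G' x)"
    proof (rule integral_dominated_convergence[where w = "\<lambda>x. norm (G' x)"])
      show "AE x in lborel. (\<lambda>n. G' x * \<phi> n x) \<longlonglongrightarrow> indicator (box a b) x * G' x"
        using AE
      proof eventually_elim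
        case (elim x)
        have "(\<lambda>n. G' x * \<phi> n x) \<longlonglongrightarrow> G' x * (indicator (box a b) x * indicator (box (0, 0) (1, 1)) x)"
          unfolding \<phi>_def by (intro tendsto_intros box_bump_tendsto)
        also have "G' x * (indicator (box a b) x * indicator (box (0, 0) (1, 1)) x) = indicator (box a b) x * G' x"
          using elim by (auto simp: G_def Omega_eq_box split: split_indicator if_splits)
        finally show ?case .
      qed
      show "AE x in lborel. norm (G' x * \<phi> n x) \<le> norm (G' x)" for n
        by (intro AE_I2) (simp add: \<phi>_def abs_mult box_bump_bounds mult_left_le mult_le_one)
    qed (use G' in auto)
    moreover have "(LINT x|lborel. G' x * \<phi> n x) = 0" for n
    proof -
      have "(LINT x|lborel. G' x * \<phi> n x) = (LINT x|lebesgue. G' x * \<phi> n x)"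
        by (rule integral_completion[symmetric]) simp
      also have "\<dots> = (LINT x|lebesgue. G x * \<phi> n x)"
        using AE' G
        by (intro integral_cong_AE)
           (auto intro!: borel_measurable_times intro: borel_measurable_integrable measurable_completion)
      also have "\<dots> = (LINT x|lebesgue. (if x \<in> Omega then g x * \<phi> n x else 0))"
        by (rule Bochner_Integration.integral_cong) (auto simp: G_def)
      also have "\<dots> = 0" using test[OF \<phi>] by (simp add: Lebesgue_Measure.integral_restrict_UNIV)
      finally show ?thesis .
    qed
    ultimately show ?thesis by (simp add: set_lebesgue_integral_def LIMSEQ_const_iff)
  qed
  have "AE x in lborel. G' x = 0" by (rule AE_zero_if_box_integrals_zero[OF G' box])
  then have "AE x in lebesgue. G x = 0"
    using AE by (intro AE_completion) (auto elim: eventually_elim2)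
  then have "AE x in lebesgue. x \<in> Omega \<longrightarrow> g x = 0" by (auto simp: G_def elim!: eventually_mono split: if_splits)
  then show ?thesis by (simp add: AE_restrict_space_iff)
qed

text \<open>The product \<open>F * G\<close> has compact support, so its derivative integrates to
  zero. Support is restricted for \<open>F\<close> alone, so that \<open>G\<close> may be a
  coordinate function in the Poincare estimate.\<close>

lemma integration_by_parts:
  fixes F G :: "real \<times> real \<Rightarrow> real"
  assumes F: "\<And>x. (F has_derivative F' x) (at x)" "continuous_on UNIV (\<lambda>x. F' x e)"
    and G: "\<And>x. (G has_derivative G' x) (at x)" "continuous_on UNIV (\<lambda>x. G' x e)"
    and K: "compact K" "K \<subseteq> Omega" "\<And>x. x \<notin> K \<Longrightarrow> F x = 0"
  shows "(LINT x|lebesgue_on Omega. F x * G' x e) = - (LINT x|lebesgue_on Omega. F' x e * G x)"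
proof -
  have FG: "continuous_on UNIV F" "continuous_on UNIV G"
    using F(1) G(1) by (auto simp: continuous_on_eq_continuous_at intro!: has_derivative_continuous simp del: split_paired_All)
  have cont: "continuous_on UNIV (\<lambda>x. F x * G' x e + F' x e * G x)"
    using F(2) G(2) FG by (intro continuous_intros)
  have F'0: "F' x e = 0" if "x \<notin> K" for x
    using derivative_zero_outside_compact[OF F(1) K(1,3) that] by simp
  have zero: "F x = 0" "F' x e = 0" if "x \<notin> Omega" for x
    using that K F'0 by blast+
  have "(LINT x|lborel. F x * G' x e + F' x e * G x) = 0"
    by (rule integral_derivative_compact_support[of "\<lambda>x. F x * G x" "\<lambda>x h. F x * G' x h + F' x h * G x", OF _ _ K(1)])
       (use F G K cont in \<open>auto intro!: has_derivative_mult simp del: split_paired_All\<close>)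
  then have "(LINT x|lebesgue_on Omega. F x * G' x e + F' x e * G x) = 0"
    using zero by (subst integral_Omega_eq_lborel) (auto intro!: borel_measurable_continuous_onI cont)
  moreover have "(LINT x|lebesgue_on Omega. F x * G' x e + F' x e * G x)
    = (LINT x|lebesgue_on Omega. F x * G' x e) + (LINT x|lebesgue_on Omega. F' x e * G x)"
    using FG F(2) G(2)
    by (intro Bochner_Integration.integral_add continuous_integrable_Omega continuous_intros)
  ultimately show ?thesis by simp
qed

section \<open>Weak partial derivatives\<close>

lemma square_integrable_rep: "square_integrable (rep_L2 u)"
  using Quotient_rep_reflp[OF Quotient_L2] by (auto simp: L2_eq_def)

lemma abs_rep_L2: "abs_L2 (rep_L2 u) = u"
  using Quotient_abs_rep[OF Quotient_L2] .

lemma AE_rep_abs: "square_integrable f \<Longrightarrow> AE x in lebesgue_on Omega. rep_L2 (abs_L2 f) x = f x"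
  using Quotient_rep_abs[OF Quotient_L2, of f] by (auto simp: L2_eq_def)

lemma measurable_rep [measurable]: "rep_L2 u \<in> borel_measurable (lebesgue_on Omega)"
  using square_integrable_rep by (simp add: square_integrable_def)

text \<open>\<open>rep_L2\<close> picks an arbitrary member of the class, so it respects the vector
  operations only almost everywhere.\<close>

lemma AE_rep_add: "AE x in lebesgue_on Omega. rep_L2 (u + v) x = rep_L2 u x + rep_L2 v x"
proof -
  have "u + v = abs_L2 (\<lambda>x. rep_L2 u x + rep_L2 v x)"
    using plus_L2.abs_eq[of "rep_L2 u" "rep_L2 v"] by (simp add: L2_eq_def square_integrable_rep abs_rep_L2)
  then show ?thesis
    using AE_rep_abs[OF square_integrable_add[OF square_integrable_rep square_integrable_rep]] by metis
qed

lemma AE_rep_scaleR: "AE x in lebesgue_on Omega. rep_L2 (c *\<^sub>R u) x = c * rep_L2 u x"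
proof -
  have "c *\<^sub>R u = abs_L2 (\<lambda>x. c * rep_L2 u x)"
    using scaleR_L2.abs_eq[of "rep_L2 u" c] by (simp add: L2_eq_def square_integrable_rep abs_rep_L2)
  then show ?thesis
    using AE_rep_abs[OF square_integrable_scale[OF square_integrable_rep]] by metis
qed

lemma inner_L2_rep: "u \<bullet> v = (LINT x|lebesgue_on Omega. rep_L2 u x * rep_L2 v x)"
  using inner_L2.abs_eq[of "rep_L2 u" "rep_L2 v"] by (simp add: L2_eq_def square_integrable_rep abs_rep_L2)

lemma inner_L2_abs:
  assumes "square_integrable f"
  shows "u \<bullet> abs_L2 f = (LINT x|lebesgue_on Omega. rep_L2 u x * f x)"
  using inner_L2.abs_eq[of "rep_L2 u" f] assms by (simp add: L2_eq_def square_integrable_rep abs_rep_L2)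

lemma inner_L2_abs_abs:
  assumes "square_integrable f" "square_integrable g"
  shows "abs_L2 f \<bullet> abs_L2 g = (LINT x|lebesgue_on Omega. f x * g x)"
  using inner_L2.abs_eq[of f g] assms by (simp add: L2_eq_def)

section \<open>Test functions and the calculus of weak derivatives\<close>

lemma test_fun_C1:
  assumes "test_fun \<phi>"
  shows "(\<phi> has_derivative frechet_derivative \<phi> (at x)) (at x)"
    and "continuous_on UNIV \<phi>"
    and "e \<in> Basis \<Longrightarrow> continuous_on UNIV (\<lambda>x. frechet_derivative \<phi> (at x) e)"
proof -
  have "C_k 1 \<phi>" and 0: "C_k 0 \<phi>" using assms unfolding test_fun_def by blast+
  then show "(\<phi> has_derivative frechet_derivative \<phi> (at x)) (at x)"
    "e \<in> Basis \<Longrightarrow> continuous_on UNIV (\<lambda>x. frechet_derivative \<phi> (at x) e)"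
    by (simp_all add: frechet_derivative_works[symmetric] del: split_paired_All)
  show "continuous_on UNIV \<phi>" using 0 by simp
qed

lemma test_fun_square_integrable:
  assumes "test_fun \<phi>"
  shows "square_integrable \<phi>"
    and "e \<in> Basis \<Longrightarrow> square_integrable (\<lambda>x. frechet_derivative \<phi> (at x) e)"
  by (intro square_integrable_continuous test_fun_C1[OF assms]; assumption)+

text \<open>In this form linearity of weak differentiation is just bilinearity of the inner
  product.\<close>

lemma is_weak_partial_inner:
  assumes "e \<in> Basis"
  shows "is_weak_partial e u g \<longleftrightarrow>
    (\<forall>\<phi>. test_fun \<phi> \<longrightarrow> u \<bullet> abs_L2 (\<lambda>x. frechet_derivative \<phi> (at x) e) = - (g \<bullet> abs_L2 \<phi>))"
  using assms by (auto simp: is_weak_partial_def inner_L2_abs test_fun_square_integrable)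

text \<open>This is the fundamental lemma restated in the Hilbert space; applied to a difference it
  gives uniqueness of weak derivatives.\<close>

lemma test_orthogonal_imp_zero:
  assumes "\<And>\<phi>. test_fun \<phi> \<Longrightarrow> g \<bullet> abs_L2 \<phi> = 0"
  shows "g = 0"
proof -
  \<comment> \<open>The constant 1 is square-integrable on the bounded square, so square-integrable
    functions are integrable.\<close>
  have "integrable (lebesgue_on Omega) (rep_L2 g)"
    using square_integrable_mult[OF square_integrable_rep[of g] square_integrable_continuous[of "\<lambda>x. 1"]] by simp
  then have "AE x in lebesgue_on Omega. rep_L2 g x = 0"
    by (rule fundamental_lemma) (use assms in \<open>simp add: inner_L2_abs test_fun_square_integrable\<close>)
  then have "g \<bullet> g = 0"
    unfolding inner_L2_rep by (intro integral_eq_zero_AE) (auto elim: eventually_mono)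
  then show ?thesis by simp
qed

lemma is_weak_partial_unique:
  assumes "e \<in> Basis" "is_weak_partial e u g" "is_weak_partial e u h"
  shows "g = h"
  using test_orthogonal_imp_zero[of "g - h"] assms by (auto simp: is_weak_partial_inner inner_diff_left)

lemma weak_partialI: "e \<in> Basis \<Longrightarrow> is_weak_partial e u g \<Longrightarrow> weak_partial e u = g"
  unfolding weak_partial_def by (rule the_equality) (auto intro: is_weak_partial_unique)

lemma is_weak_partial_weak_partial:
  "u \<in> H1 \<Longrightarrow> e \<in> Basis \<Longrightarrow> is_weak_partial e u (weak_partial e u)"
  unfolding H1_def by (auto simp: weak_partialI simp del: split_paired_All)

lemma is_weak_partial_add:
  "e \<in> Basis \<Longrightarrow> is_weak_partial e u g \<Longrightarrow> is_weak_partial e v h \<Longrightarrow> is_weak_partial e (u + v) (g + h)"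
  by (simp add: is_weak_partial_inner inner_add_left)

lemma is_weak_partial_scaleR:
  "e \<in> Basis \<Longrightarrow> is_weak_partial e u g \<Longrightarrow> is_weak_partial e (c *\<^sub>R u) (c *\<^sub>R g)"
  by (simp add: is_weak_partial_inner)

lemma is_weak_partial_diff:
  "e \<in> Basis \<Longrightarrow> is_weak_partial e u g \<Longrightarrow> is_weak_partial e v h \<Longrightarrow> is_weak_partial e (u - v) (g - h)"
  by (simp add: is_weak_partial_inner inner_diff_left)

text \<open>Classical derivatives are weak ones by integration by parts, with no boundary term
  because \<open>\<phi>\<close> has compact support.\<close>

lemma is_weak_partial_test_fun:
  assumes "test_fun \<phi>" "e \<in> Basis"
  shows "is_weak_partial e (abs_L2 \<phi>) (abs_L2 (\<lambda>x. frechet_derivative \<phi> (at x) e))"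
  unfolding is_weak_partial_inner[OF assms(2)]
proof (intro allI impI)
  fix \<psi> assume \<psi>: "test_fun \<psi>"
  note sq = test_fun_square_integrable[OF assms(1)] test_fun_square_integrable[OF \<psi>]
  obtain K where "compact K" "K \<subseteq> Omega" "\<And>x. x \<notin> K \<Longrightarrow> \<phi> x = 0"
    using assms(1) unfolding test_fun_def by blast
  then show "abs_L2 \<phi> \<bullet> abs_L2 (\<lambda>x. frechet_derivative \<psi> (at x) e)
    = - (abs_L2 (\<lambda>x. frechet_derivative \<phi> (at x) e) \<bullet> abs_L2 \<psi>)"
    using sq assms(2) integration_by_parts[OF test_fun_C1(1)[OF assms(1)] test_fun_C1(3)[OF assms]
        test_fun_C1(1)[OF \<psi>] test_fun_C1(3)[OF \<psi> assms(2)], of K]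
    by (simp add: inner_L2_abs_abs)
qed

text \<open>Integrate by parts against the first coordinate, whose partial derivative is \<open>1\<close>.\<close>

lemma poincare_test_fun:
  assumes "test_fun \<phi>"
  shows "norm (abs_L2 \<phi>) \<le> 2 * norm (abs_L2 (\<lambda>x. frechet_derivative \<phi> (at x) (1, 0)))"
proof -
  let ?d = "\<lambda>x. frechet_derivative \<phi> (at x) (1, 0)"
  have e: "(1, 0) \<in> (Basis :: (real \<times> real) set)" by (simp add: Basis_prod_def)
  note C1 = test_fun_C1[OF assms] and d = test_fun_C1(3)[OF assms e]
  note sq = test_fun_square_integrable(1)[OF assms] test_fun_square_integrable(2)[OF assms e]
  \<comment> \<open>On the square the first coordinate is at most 1, so \<open>\<psi>\<close> is
    dominated by \<open>\<phi>\<close> and the final estimate can be divided by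
    \<open>norm (abs_L2 \<phi>)\<close>.\<close>
  define \<psi> where "\<psi> x = fst x * \<phi> x" for x
  have \<psi>: "continuous_on UNIV \<psi>" unfolding \<psi>_def by (intro continuous_intros C1)
  obtain K where K: "compact K" "K \<subseteq> Omega" "\<And>x. x \<notin> K \<Longrightarrow> (\<phi> x)\<^sup>2 = 0"
    using assms unfolding test_fun_def by fastforce
  \<comment> \<open>Integration by parts with the square of \<open>\<phi>\<close> as
    \<open>F\<close> and \<open>fst\<close> as \<open>G\<close>; \<open>fst (1, 0)\<close> is the
    derivative of \<open>fst\<close> along the first axis.\<close>
  have "(LINT x|lebesgue_on Omega. (\<phi> x)\<^sup>2 * fst (1 :: real, 0 :: real))
      = - (LINT x|lebesgue_on Omega. (2 * \<phi> x * ?d x) * fst x)"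
  proof (rule integration_by_parts[OF _ _ _ _ K])
    show "((\<lambda>x. (\<phi> x)\<^sup>2) has_derivative (\<lambda>h. 2 * \<phi> x * frechet_derivative \<phi> (at x) h)) (at x)" for x
      using has_derivative_power[OF C1(1)[of x], where n = 2] by (simp add: algebra_simps)
    show "continuous_on UNIV (\<lambda>x. 2 * \<phi> x * ?d x)" by (intro continuous_intros C1 d)
  qed (auto intro!: derivative_eq_intros)
  also have "- (LINT x|lebesgue_on Omega. (2 * \<phi> x * ?d x) * fst x)
      = - (LINT x|lebesgue_on Omega. 2 * (\<psi> x * ?d x))"
    by (simp add: \<psi>_def algebra_simps)
  finally have "(norm (abs_L2 \<phi>))\<^sup>2 = - 2 * (abs_L2 \<psi> \<bullet> abs_L2 ?d)"
    using sq square_integrable_continuous[OF \<psi>]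
    by (simp add: power2_norm_eq_inner inner_L2_abs_abs flip: power2_eq_square)
  also have "\<dots> \<le> 2 * \<bar>abs_L2 \<psi> \<bullet> abs_L2 ?d\<bar>" by simp
  also have "\<dots> \<le> 2 * (norm (abs_L2 \<psi>) * norm (abs_L2 ?d))"
    by (intro mult_left_mono Cauchy_Schwarz_ineq2) simp
  also have "\<dots> \<le> 2 * (norm (abs_L2 \<phi>) * norm (abs_L2 ?d))"
  proof (intro mult_left_mono mult_right_mono)
    have "abs_L2 \<psi> \<bullet> abs_L2 \<psi> \<le> abs_L2 \<phi> \<bullet> abs_L2 \<phi>"
      unfolding inner_L2_abs_abs[OF square_integrable_continuous[OF \<psi>] square_integrable_continuous[OF \<psi>]] inner_L2_abs_abs[OF sq(1) sq(1)]
    proof (rule integral_mono)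
      fix x assume "x \<in> space (lebesgue_on Omega)"
      then have "\<bar>fst x\<bar> \<le> 1" by (auto simp: Omega_def)
      then have "\<bar>\<psi> x\<bar> \<le> \<bar>\<phi> x\<bar>" by (simp add: \<psi>_def abs_mult mult_left_le_one_le)
      then show "\<psi> x * \<psi> x \<le> \<phi> x * \<phi> x" by (simp add: abs_le_square_iff power2_eq_square[symmetric])
    qed (intro square_integrable_mult square_integrable_continuous[OF \<psi>] sq)+
    then show "norm (abs_L2 \<psi>) \<le> norm (abs_L2 \<phi>)" by (simp add: norm_le)
  qed auto
  finally have "norm (abs_L2 \<phi>) * norm (abs_L2 \<phi>) \<le> norm (abs_L2 \<phi>) * (2 * norm (abs_L2 ?d))"
    by (simp add: power2_eq_square algebra_simps)
  then show ?thesis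
    by (cases "abs_L2 \<phi> = 0") (auto simp: mult_le_cancel_left)
qed

text \<open>If \<open>\<phi>\<close> is close to \<open>u\<close> in \<open>H1_norm\<close> and
  \<open>u\<close> has zero gradient, the gradient of \<open>\<phi>\<close> is small; Poincare makes
  \<open>\<phi>\<close>, and hence \<open>u\<close>, small.\<close>

lemma H10_zero_gradient:
  assumes u: "u \<in> H10" and zero: "\<And>e. e \<in> Basis \<Longrightarrow> weak_partial e u = 0"
  shows "u = 0"
proof -
  let ?e = "(1, 0) :: real \<times> real"
  have e: "?e \<in> Basis" by (simp add: Basis_prod_def)
  have "norm u \<le> \<epsilon>" if "\<epsilon> > 0" for \<epsilon>
  proof -
    \<comment> \<open>One third pays for the distance from \<open>u\<close> to
      \<open>\<phi>\<close>, two thirds for \<open>\<phi>\<close> through the Poincare constant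
      2.\<close>
    have "\<epsilon> / 3 > 0" using that by simp
    then obtain \<phi> where \<phi>: "test_fun \<phi>" and lt: "H1_norm (u - abs_L2 \<phi>) < \<epsilon> / 3"
      using u unfolding H10_def by blast
    let ?d = "\<lambda>x. frechet_derivative \<phi> (at x) ?e"
    have "is_weak_partial ?e u 0"
      using is_weak_partial_weak_partial[OF _ e] zero[OF e] u by (metis (mono_tags) H10_def mem_Collect_eq)
    then have wp: "weak_partial ?e (u - abs_L2 \<phi>) = - abs_L2 ?d"
      using weak_partialI[OF e is_weak_partial_diff[OF e _ is_weak_partial_test_fun[OF \<phi> e]]] by fastforce
    have "norm (u - abs_L2 \<phi>) \<le> H1_norm (u - abs_L2 \<phi>)"
      unfolding H1_norm_def by (rule real_le_rsqrt) (simp add: sum_nonneg)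
    moreover have "norm (abs_L2 ?d) \<le> H1_norm (u - abs_L2 \<phi>)"
      unfolding H1_norm_def
    proof (rule real_le_rsqrt)
      have "(norm (abs_L2 ?d))\<^sup>2 \<le> (\<Sum>e\<in>Basis. (norm (weak_partial e (u - abs_L2 \<phi>)))\<^sup>2)"
        using member_le_sum[OF e, of "\<lambda>e. (norm (weak_partial e (u - abs_L2 \<phi>)))\<^sup>2"] wp by simp
      then show "(norm (abs_L2 ?d))\<^sup>2 \<le> (norm (u - abs_L2 \<phi>))\<^sup>2 + (\<Sum>e\<in>Basis. (norm (weak_partial e (u - abs_L2 \<phi>)))\<^sup>2)"
        by (smt (verit) zero_le_power2)
    qed
    moreover have "norm u \<le> norm (u - abs_L2 \<phi>) + norm (abs_L2 \<phi>)"
      using norm_triangle_ineq[of "u - abs_L2 \<phi>" "abs_L2 \<phi>"] by simp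
    ultimately show ?thesis using poincare_test_fun[OF \<phi>] lt by linarith
  qed
  then have "norm u \<le> 0" by (rule field_le_epsilon[of _ 0, simplified])
  then show ?thesis by simp
qed

section \<open>Positive definite forms\<close>

text \<open>The laws are confined to \<open>V\<close> because \<open>weak_partial\<close> is
  unspecified outside \<open>H1\<close>, so the energy form is not known to be bilinear on all of
  \<open>L2\<close>.\<close>

locale positive_form =
  fixes V :: "'a::real_vector set" and a :: "'a \<Rightarrow> 'a \<Rightarrow> real"
  assumes subspace_V: "subspace V"
    and add_left: "u \<in> V \<Longrightarrow> v \<in> V \<Longrightarrow> w \<in> V \<Longrightarrow> a (u + v) w = a u w + a v w"
    and scale_left: "u \<in> V \<Longrightarrow> w \<in> V \<Longrightarrow> a (c *\<^sub>R u) w = c * a u w"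
    and sym: "u \<in> V \<Longrightarrow> v \<in> V \<Longrightarrow> a u v = a v u"
    and nonneg: "u \<in> V \<Longrightarrow> 0 \<le> a u u"
    and definite: "u \<in> V \<Longrightarrow> a u u = 0 \<Longrightarrow> u = 0"
begin

lemma mem: "u \<in> V \<Longrightarrow> v \<in> V \<Longrightarrow> u + v \<in> V" "u \<in> V \<Longrightarrow> v \<in> V \<Longrightarrow> u - v \<in> V"
  "u \<in> V \<Longrightarrow> c *\<^sub>R u \<in> V"
  using subspace_V by (auto simp: subspace_add subspace_diff subspace_scale)

lemma diff_left: "u \<in> V \<Longrightarrow> v \<in> V \<Longrightarrow> w \<in> V \<Longrightarrow> a (u - v) w = a u w - a v w"
  using add_left[of "u - v" v w] mem by simp

lemma add_right: "u \<in> V \<Longrightarrow> v \<in> V \<Longrightarrow> w \<in> V \<Longrightarrow> a w (u + v) = a w u + a w v"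
  and scale_right: "u \<in> V \<Longrightarrow> w \<in> V \<Longrightarrow> a w (c *\<^sub>R u) = c * a w u"
  using add_left[of u v w] scale_left[of u w c] by (simp_all add: sym mem)

text \<open>Gram-Schmidt by induction on the spanning set. The vector \<open>v\<close> stays
  arbitrary because the hypothesis is applied both to it and to the new vector
  \<open>b\<close>.\<close>

lemma projection_exists:
  assumes "finite B" "B \<subseteq> V" "v \<in> V"
  shows "\<exists>w\<in>span B. \<forall>z\<in>span B. a w z = a v z"
  using assms
proof (induction B arbitrary: v)
  case empty
  have "a 0 0 = a v 0" using scale_right[of 0 v 0] scale_right[of 0 0 0] subspace_0[OF subspace_V] empty by simp
  then show ?case by simp
next
  case (insert b B)
  have BV: "x \<in> V" if "x \<in> span B" for x
    using span_minimal[OF _ subspace_V, of B] insert.prems that by auto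
  obtain q where q: "q \<in> span B" "\<And>z. z \<in> span B \<Longrightarrow> a q z = a b z"
    using insert.IH[of b] insert.prems by auto
  obtain p where p: "p \<in> span B" "\<And>z. z \<in> span B \<Longrightarrow> a p z = a v z"
    using insert.IH[of v] insert.prems by auto
  define b' where "b' = b - q"
  define c where "c = a v b' / a b' b'"
  have V: "b \<in> V" "q \<in> V" "p \<in> V" "b' \<in> V" "v \<in> V"
    using insert.prems BV q p mem by (auto simp: b'_def)
  have orth: "a b' z = 0" if "z \<in> span B" for z
    using that q V BV by (simp add: b'_def diff_left)
  \<comment> \<open>If \<open>b\<close> already lies in the span of \<open>B\<close>, then
    \<open>b'\<close> is zero and both sides vanish, whatever the division in \<open>c\<close>
    yields.\<close>
  have c: "c * a b' b' = a v b'"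
  proof (cases "a b' b' = 0")
    case True
    then have "b' = 0" using definite V by simp
    then have "a v b' = 0" using scale_right[of 0 v 0] V by simp
    then show ?thesis using True by simp
  qed (simp add: c_def)
  have "a (p + c *\<^sub>R b') z = a v z" if z: "z \<in> span (insert b B)" for z
  proof -
    obtain k where k: "z - k *\<^sub>R b \<in> span B" using z by (auto simp: span_breakdown_eq)
    \<comment> \<open>split off the component along \<open>b'\<close>, which is orthogonal to the span of \<open>B\<close>\<close>
    define s where "s = z - k *\<^sub>R b + k *\<^sub>R q"
    have s: "s \<in> span B" using k q by (simp add: s_def span_add span_scale)
    have "z = k *\<^sub>R b' + s" by (simp add: s_def b'_def algebra_simps)
    moreover have "a p b' = 0" using orth[OF p(1)] V sym by simp
    moreover have "a (c *\<^sub>R b') (k *\<^sub>R b') = k * a v b'"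
      using V mem c by (simp add: scale_left scale_right)
    ultimately show ?thesis
      using V BV[OF s] mem p(2)[OF s] orth[OF s]
      by (simp add: add_left add_right scale_left scale_right)
  qed
  moreover have "p + c *\<^sub>R b' \<in> span (insert b B)"
  proof -
    have "x \<in> span (insert b B)" if "x \<in> span B" for x using that span_mono[of B "insert b B"] by auto
    then show ?thesis using p q by (simp add: b'_def span_add span_scale span_diff span_base)
  qed
  ultimately show ?case by blast
qed

text \<open>The difference lies in \<open>W\<close> and can serve as its own test vector;
  definiteness finishes.\<close>

lemma projection_unique:
  assumes W: "subspace W" "W \<subseteq> V" and w: "w \<in> W" "w' \<in> W"
    and eq: "\<And>z. z \<in> W \<Longrightarrow> a w z = a w' z"
  shows "w = w'"
proof -
  have "w - w' \<in> W" using W w by (simp add: subspace_diff)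
  then have "a (w - w') (w - w') = 0" using eq W w by (simp add: diff_left subset_iff)
  then have "w - w' = 0" using definite \<open>w - w' \<in> W\<close> W by blast
  then show ?thesis by simp
qed

lemma best_approximation:
  assumes W: "subspace W" "W \<subseteq> V" and v: "v \<in> V" and w: "w \<in> W" "y \<in> W"
    and eq: "\<And>z. z \<in> W \<Longrightarrow> a w z = a v z"
  shows "a (v - w) (v - w) \<le> a (v - y) (v - y)"
proof -
  have d: "w - y \<in> W" using W w by (simp add: subspace_diff)
  have V: "v - w \<in> V" "w - y \<in> V" "w \<in> V" using v w W d mem by auto
  have 0: "a (v - w) (w - y) = 0" using eq[OF d] V v by (simp add: diff_left)
  \<comment> \<open>Pythagoras: the error \<open>v - w\<close> is orthogonal to the displacement
    \<open>w - y\<close> inside \<open>W\<close>.\<close>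
  have "a (v - y) (v - y) = a ((v - w) + (w - y)) ((v - w) + (w - y))" by simp
  also have "\<dots> = a (v - w) (v - w) + a (w - y) (w - y)"
    using 0 sym[of "v - w" "w - y"] V mem(1)[OF V(1,2)] by (simp only: add_left add_right)
  finally show ?thesis using nonneg[OF V(2)] by simp
qed

end

section \<open>The energy form and the reduced space\<close>

locale coefficient =
  fixes \<kappa> :: "real \<times> real \<Rightarrow> real" and \<kappa>min \<kappa>max :: real
  assumes measurable_\<kappa> [measurable]: "\<kappa> \<in> borel_measurable (lebesgue_on Omega)"
    and \<kappa>min_pos: "0 < \<kappa>min"
    and \<kappa>_bounds: "x \<in> Omega \<Longrightarrow> \<kappa>min \<le> \<kappa> x \<and> \<kappa> x \<le> \<kappa>max"
begin

text \<open>The weighted inner product isolates everything that depends on the coefficient; the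
  energy form sums it over the partial derivatives.\<close>

definition weighted :: "L2 \<Rightarrow> L2 \<Rightarrow> real" where
  "weighted g h = (LINT x|lebesgue_on Omega. \<kappa> x * (rep_L2 g x * rep_L2 h x))"

lemma weighted_integrable: "integrable (lebesgue_on Omega) (\<lambda>x. \<kappa> x * (rep_L2 g x * rep_L2 h x))"
proof (rule Bochner_Integration.integrable_bound)
  show "integrable (lebesgue_on Omega) (\<lambda>x. \<kappa>max * (rep_L2 g x * rep_L2 h x))"
    by (intro integrable_mult_right square_integrable_mult square_integrable_rep)
  show "AE x in lebesgue_on Omega. norm (\<kappa> x * (rep_L2 g x * rep_L2 h x)) \<le> norm (\<kappa>max * (rep_L2 g x * rep_L2 h x))"
  proof (rule AE_I2)
    fix x assume "x \<in> space (lebesgue_on Omega)"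
    then have "\<bar>\<kappa> x\<bar> \<le> \<bar>\<kappa>max\<bar>" using \<kappa>_bounds[of x] \<kappa>min_pos by simp
    then show "norm (\<kappa> x * (rep_L2 g x * rep_L2 h x)) \<le> norm (\<kappa>max * (rep_L2 g x * rep_L2 h x))"
      unfolding real_norm_def abs_mult by (intro mult_right_mono) auto
  qed
qed simp

lemma weighted_sym: "weighted g h = weighted h g"
  by (simp add: weighted_def mult.commute)

lemma weighted_add: "weighted (g + g') h = weighted g h + weighted g' h"
proof -
  have "weighted (g + g') h = (LINT x|lebesgue_on Omega.
      \<kappa> x * (rep_L2 g x * rep_L2 h x) + \<kappa> x * (rep_L2 g' x * rep_L2 h x))"
    unfolding weighted_def using AE_rep_add[of g g']
    by (intro integral_cong_AE) (auto simp: algebra_simps elim!: eventually_mono)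
  then show ?thesis by (simp add: weighted_integrable weighted_def)
qed

lemma weighted_scaleR: "weighted (c *\<^sub>R g) h = c * weighted g h"
proof -
  have "weighted (c *\<^sub>R g) h = (LINT x|lebesgue_on Omega. c * (\<kappa> x * (rep_L2 g x * rep_L2 h x)))"
    unfolding weighted_def using AE_rep_scaleR[of c g]
    by (intro integral_cong_AE) (auto simp: algebra_simps elim!: eventually_mono)
  then show ?thesis by (simp add: weighted_def)
qed

lemma weighted_coercive: "\<kappa>min * (norm g)\<^sup>2 \<le> weighted g g"
proof -
  have "\<kappa>min * (norm g)\<^sup>2 = (LINT x|lebesgue_on Omega. \<kappa>min * (rep_L2 g x * rep_L2 g x))"
    by (simp add: power2_norm_eq_inner inner_L2_rep)
  also have "\<dots> \<le> weighted g g"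
    unfolding weighted_def
  proof (rule integral_mono)
    fix x assume "x \<in> space (lebesgue_on Omega)"
    then show "\<kappa>min * (rep_L2 g x * rep_L2 g x) \<le> \<kappa> x * (rep_L2 g x * rep_L2 g x)"
      using \<kappa>_bounds[of x] by (intro mult_right_mono) auto
  qed (intro weighted_integrable integrable_mult_right square_integrable_mult square_integrable_rep)+
  finally show ?thesis .
qed

lemma energy_form_weighted:
  "energy_form \<kappa> u v = (\<Sum>e\<in>Basis. weighted (weak_partial e u) (weak_partial e v))"
  unfolding energy_form_def weighted_def
  by (simp add: sum_distrib_left Bochner_Integration.integral_sum weighted_integrable)

text \<open>Bilinearity comes from linearity of \<open>weak_partial\<close> on \<open>H1\<close>.
  Definiteness comes from the lower bound on the coefficient, which forces a zero gradient, and from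
  the boundary condition in \<open>H10\<close>.\<close>

lemma positive_form_energy:
  assumes "subspace V" "V \<subseteq> H10"
  shows "positive_form V (energy_form \<kappa>)"
proof
  have H1: "u \<in> H1" if "u \<in> V" for u using that assms by (auto simp: H10_def)
  note wp = is_weak_partial_weak_partial[OF H1]
  show "energy_form \<kappa> (u + v) w = energy_form \<kappa> u w + energy_form \<kappa> v w"
    if "u \<in> V" "v \<in> V" "w \<in> V" for u v w
  proof -
    have "weak_partial e (u + v) = weak_partial e u + weak_partial e v" if "e \<in> Basis" for e
      using that \<open>u \<in> V\<close> \<open>v \<in> V\<close> by (intro weak_partialI is_weak_partial_add wp)
    then show ?thesis by (simp add: energy_form_weighted weighted_add sum.distrib)
  qed
  show "energy_form \<kappa> (c *\<^sub>R u) w = c * energy_form \<kappa> u w" if "u \<in> V" "w \<in> V" for u w c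
  proof -
    have "weak_partial e (c *\<^sub>R u) = c *\<^sub>R weak_partial e u" if "e \<in> Basis" for e
      using that \<open>u \<in> V\<close> by (intro weak_partialI is_weak_partial_scaleR wp)
    then show ?thesis by (simp add: energy_form_weighted weighted_scaleR sum_distrib_left)
  qed
  show "energy_form \<kappa> u v = energy_form \<kappa> v u" for u v
    by (simp add: energy_form_weighted weighted_sym)
  have nonneg: "0 \<le> weighted g g" for g
    using weighted_coercive[of g] \<kappa>min_pos by (smt (verit) mult_nonneg_nonneg zero_le_power2)
  then show "0 \<le> energy_form \<kappa> u u" for u
    by (simp add: energy_form_weighted sum_nonneg)
  show "u = 0" if "u \<in> V" "energy_form \<kappa> u u = 0" for u
  proof (rule H10_zero_gradient)
    show "u \<in> H10" using that assms by auto
    fix e :: "real \<times> real" assume "e \<in> Basis"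
    then have "weighted (weak_partial e u) (weak_partial e u) = 0"
      using that nonneg by (simp add: energy_form_weighted sum_nonneg_eq_0_iff)
    then have "\<kappa>min * (norm (weak_partial e u))\<^sup>2 \<le> 0" using weighted_coercive by metis
    then show "weak_partial e u = 0" using \<kappa>min_pos by (simp add: mult_le_0_iff)
  qed
qed (rule assms)

end

section \<open>Finite dimension of the reduced space\<close>

lemma linear_projection_image_span:
  assumes P: "linear_projection_onto D V P" and S: "span S \<subseteq> D"
  shows "P ` span S = span (P ` S)"
proof -
  have D: "subspace D" and add: "\<And>u v. u \<in> D \<Longrightarrow> v \<in> D \<Longrightarrow> P (u + v) = P u + P v"
    and scale: "\<And>c u. u \<in> D \<Longrightarrow> P (c *\<^sub>R u) = c *\<^sub>R P u"
    using P unfolding linear_projection_onto_def by blast+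
  have P0: "P 0 = 0" using scale[of 0 0] subspace_0[OF D] by simp
  show ?thesis
  proof
    show "P ` span S \<subseteq> span (P ` S)"
    proof clarify
      fix x assume "x \<in> span S"
      \<comment> \<open>Membership in \<open>span S\<close> is carried through the induction so that
        the vectors stay in \<open>D\<close>, where \<open>P\<close> is linear.\<close>
      then have "x \<in> span S \<and> P x \<in> span (P ` S)"
      proof (induction rule: span_induct_alt)
        case (step c x y)
        then have "x \<in> span S" "x \<in> D" "y \<in> D" using S by (auto intro: span_base)
        then show ?case using step D
          by (simp add: add scale subspace_scale span_add span_scale span_base)
      qed (simp add: P0 span_zero)
      then show "P x \<in> span (P ` S)" ..
    qed
    have "subspace (P ` span S)"
    proof (rule subspaceI)
      show "0 \<in> P ` span S" using P0 span_zero by (metis imageI)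
      fix x y c assume "x \<in> P ` span S" "y \<in> P ` span S"
      then obtain x' y' where *: "x = P x'" "y = P y'" "x' \<in> span S" "y' \<in> span S" by auto
      then have "x + y = P (x' + y')" "c *\<^sub>R x = P (c *\<^sub>R x')" using add scale S by (simp_all add: subset_iff)
      then show "x + y \<in> P ` span S" "c *\<^sub>R x \<in> P ` span S"
        using * by (auto intro: span_add span_scale)
    qed
    then show "span (P ` S) \<subseteq> P ` span S"
      by (intro span_minimal image_mono span_superset)
  qed
qed

text \<open>This supplies the finite spanning set that Gram-Schmidt requires: the images of the sine
  modes.\<close>

lemma reduced_space_eq_span:
  assumes "linear_projection_onto D V P" "sine_space M \<subseteq> D"
  obtains B where "finite B" "reduced_space P M = span B"
proof
  let ?S = "{abs_L2 (sine_mode m n) | m n. m \<in> {1..M} \<and> n \<in> {1..M}}"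
  have "?S = (\<lambda>(m, n). abs_L2 (sine_mode m n)) ` ({1..M} \<times> {1..M})" by fastforce
  then have "finite ?S" by (metis (no_types) finite_atLeastAtMost finite_SigmaI finite_imageI)
  then show "finite (P ` ?S)" by (rule finite_imageI)
  show "reduced_space P M = span (P ` ?S)"
    using assms unfolding reduced_space_def sine_space_def by (rule linear_projection_image_span)
qed

theorem theorem3p1:
  fixes \<kappa> f :: "real \<times> real \<Rightarrow> real" and \<kappa>min \<kappa>max :: real
    and Vh D :: "L2 set" and M :: nat and Pih :: "L2 \<Rightarrow> L2" and uh :: L2
  assumes "\<kappa> \<in> borel_measurable (lebesgue_on Omega)"
    and "0 < \<kappa>min"
    and "\<And>x. x \<in> Omega \<Longrightarrow> \<kappa>min \<le> \<kappa> x \<and> \<kappa> x \<le> \<kappa>max"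
    and "admissible_data f"
    and "subspace Vh" and "Vh \<subseteq> H10" and "\<exists>B. finite B \<and> Vh = span B"
    and "1 \<le> M"
    and "linear_projection_onto D Vh Pih" and "sine_space M \<subseteq> D"
    and "galerkin_solution \<kappa> f Vh uh"
  shows "uh = energy_projector \<kappa> (reduced_space Pih M) uh
              + (uh - energy_projector \<kappa> (reduced_space Pih M) uh)
     \<and> energy_projector \<kappa> (reduced_space Pih M) uh \<in> reduced_space Pih M
     \<and> (\<forall>vM\<in>reduced_space Pih M.
          energy_form \<kappa> (uh - energy_projector \<kappa> (reduced_space Pih M) uh) vM = 0)
     \<and> (\<exists>!uRD. galerkin_solution \<kappa> f (reduced_space Pih M) uRD)
     \<and> (\<forall>uRD. galerkin_solution \<kappa> f (reduced_space Pih M) uRD \<longrightarrow>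
          uRD = energy_projector \<kappa> (reduced_space Pih M) uh \<and>
          is_arg_min (\<lambda>vM. energy_norm \<kappa> (uh - vM)) (\<lambda>vM. vM \<in> reduced_space Pih M) uRD)"
proof -
  interpret coefficient \<kappa> \<kappa>min \<kappa>max by standard (use assms in auto)
  interpret positive_form Vh "energy_form \<kappa>" by (rule positive_form_energy) fact+
  let ?W = "reduced_space Pih M" and ?p = "energy_projector \<kappa> (reduced_space Pih M) uh"
  obtain B where B: "finite B" "?W = span B" using assms(9,10) by (rule reduced_space_eq_span)
  have W: "subspace ?W" by (simp add: B)
  have WV: "?W \<subseteq> Vh"
    using assms(9,10) unfolding reduced_space_def linear_projection_onto_def by blast
  have BV: "B \<subseteq> Vh" using WV B span_superset by blast
  have uh: "uh \<in> Vh" "\<And>v. v \<in> Vh \<Longrightarrow> energy_form \<kappa> uh v = load f v"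
    using assms(11) by (auto simp: galerkin_solution_def)
  obtain w where w: "w \<in> ?W" "\<And>z. z \<in> ?W \<Longrightarrow> energy_form \<kappa> w z = energy_form \<kappa> uh z"
    using projection_exists[OF B(1) BV uh(1)] B(2) by auto
  have p: "?p = w"
    unfolding energy_projector_def
    by (rule the_equality) (use w projection_unique[OF W WV] in auto)
  \<comment> \<open>On \<open>reduced_space Pih M\<close>, a subset of \<open>Vh\<close>, the load
    equals the energy pairing with \<open>uh\<close>, so the reduced problem is the equation
    defining the projection.\<close>
  have galerkin_iff: "galerkin_solution \<kappa> f ?W v \<longleftrightarrow> v = w" for v
    using w uh(2) WV projection_unique[OF W WV, of v w] by (auto simp: galerkin_solution_def subset_iff)
  have "energy_form \<kappa> (uh - w) z = 0" if "z \<in> ?W" for z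
    using w that uh WV by (subst diff_left) auto
  moreover have "is_arg_min (\<lambda>vM. energy_norm \<kappa> (uh - vM)) (\<lambda>vM. vM \<in> ?W) w"
    using best_approximation[OF W WV uh(1) w(1) _ w(2)] w(1)
    by (auto simp: is_arg_min_linorder energy_norm_def)
  ultimately show ?thesis
    using w by (simp add: p galerkin_iff)
qed

end
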